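(* Let $\mu_0,\mu_1\in\mathcal M$, let $(\mu_t,V_t,h_t)_{t\in[0,1]}\in\mathcal{CE}_p(\mu_0,\mu_1;[0,1])$, and let $h^*$ be the decreasing rearrangement of $h$. Let $\nu_t$ be the unique absolutely continuous solution of $$\dot\nu_t+\nabla\cdot V_t=h^*_t\,p,\qquad\nu_0=\mu_0 .$$ Then $(\nu_t,V_t,h^*_t)_{t\in[0,1]}\in\mathcal{CE}_p(\mu_0,\mu_1;[0,1])$ and $$\mathfrak E^{a,b}_{\rm Quad}\big((\mu_t,V_t,h_t)_{t\in[0,1]}\big)\ge\mathfrak E^{a,b}_{\rm Quad}\big((\nu_t,V_t,h^*_t)_{t\in[0,1]}\big).$$
   Context: Setting. $\mathcal X$ is a finite set, $K:\mathcal X\times\mathcal X\to[0,\infty)$ an irreducible Markov kernel ($\sum_y K(x,y)=1$) with unique invariant probability $\varpi$ ($\varpi(x)=\sum_y\varpi(y)K(y,x)$, $\sum_y\varpi(y)=1$), assumed reversible: $K(x,y)\varpi(x)=K(y,x)\varpi(y)$. $\mathcal M$ is the set of $\mu:\mathcal X\to[0,\infty)$ and $\mathcal M_+$ the set of $\mu:\mathcal X\to(0,\infty)$. Fix $a,b>0$ and $p\in\mathcal M_+$ with $\sum_x p(x)\varpi(x)=1$. Notation. $(\nabla\cdot\Psi)(x)=\frac12\sum_y(\Psi(x,y)-\Psi(y,x))K(x,y)$ for $\Psi\in\mathbb R^{\mathcal X\times\mathcal X}$. Logarithmic mean: $\theta(u,v)=\int_0^1u^\xi v^{1-\xi}\,d\xi$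 for $u,v\ge0$, i.e. $\theta(u,u)=u$, $\theta(u,v)=\frac{u-v}{\log u-\log v}$ for $u\ne v$ positive, and $\theta(u,v)=0$ if $u=0$ or $v=0$. Flux formulation. $\mathcal{CE}_p(\mu_0,\mu_1;[0,1])$ is the set of triples $(\mu_t,V_t,h_t)_{t\in[0,1]}$ with $t\mapsto\mu_t\in\mathcal M$ absolutely continuous with endpoints $\mu_0$ (at $t=0$) and $\mu_1$ (at $t=1$), $V:[0,1]\to\mathbb R^{\mathcal X\times\mathcal X}$ and $h:[0,1]\to\mathbb R$ measurable, and $\dot\mu_t+\nabla\cdot V_t=h_tp$ for a.e. $t$ (so that $h_t=\frac{d}{dt}\sum_x\mu_t(x)\varpi(x)$ a.e., and $h\in L^1([0,1])$). Let $\alpha(v,s,t)=v^2/\theta(s,t)$ for $v\in\mathbb R$, $s,t\ge0$, with $v^2/0=0$ if $v=0$ and $v^2/0=+\infty$ if $v\neq0$; $A'(\mu,V)=\frac12\sum_{x,y}\alpha(V(x,y),\mu(x),\mu(y))K(x,y)\varpi(x)$ (with $0\cdot\infty=0$); and $\mathfrak E^{a,b}_{\rm Quad}((\mu_t,V_t,h_t)_{t\in[0,1]})=a^2\int_0^1|h_t|^2dt+b^2\int_0^1A'(\mu_t,V_t)\,dt\in[0,\infty]$. Decreasing rearrangement. For $f\in L^1([0,1];\mathbb R)$ and $\lambda$ Lebesgue measure, let $F_f(\alpha)=\lambda\{t\in[0,1]:f(t)>\alpha\}$; the decreasing rearrangement is $f^*(u)=\inf\{\alpha\in\mathbb R:F_f(\alpha)\le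 u\}$, $u\in(0,1)$. *)

theory Defs
  imports "HOL-Analysis.Analysis"
begin

section \<open>Reversible Markov kernels on a finite set\<close>

definition markov_kernel :: "('x::finite \<Rightarrow> 'x \<Rightarrow> real) \<Rightarrow> bool" where
  "markov_kernel K \<longleftrightarrow> (\<forall>x y. 0 \<le> K x y) \<and> (\<forall>x. (\<Sum>y\<in>UNIV. K x y) = 1)"

definition irreducible_kernel :: "('x::finite \<Rightarrow> 'x \<Rightarrow> real) \<Rightarrow> bool" where
  "irreducible_kernel K \<longleftrightarrow> (\<forall>x y. (\<lambda>u v. 0 < K u v)\<^sup>*\<^sup>* x y)"

definition invariant_probability :: "('x::finite \<Rightarrow> 'x \<Rightarrow> real) \<Rightarrow> ('x \<Rightarrow> real) \<Rightarrow> bool" where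
  "invariant_probability K \<pi> \<longleftrightarrow>
     (\<forall>x. 0 \<le> \<pi> x) \<and> (\<Sum>y\<in>UNIV. \<pi> y) = 1 \<and> (\<forall>x. \<pi> x = (\<Sum>y\<in>UNIV. \<pi> y * K y x))"

definition reversible_kernel :: "('x::finite \<Rightarrow> 'x \<Rightarrow> real) \<Rightarrow> ('x \<Rightarrow> real) \<Rightarrow> bool" where
  "reversible_kernel K \<pi> \<longleftrightarrow> (\<forall>x y. K x y * \<pi> x = K y x * \<pi> y)"

definition nonneg_densities :: "('x \<Rightarrow> real) set" where
  "nonneg_densities = {\<mu>. \<forall>x. 0 \<le> \<mu> x}"

definition pos_densities :: "('x \<Rightarrow> real) set" where
  "pos_densities = {\<mu>. \<forall>x. 0 < \<mu> x}"

definition kernel_div :: "('x::finite \<Rightarrow> 'x \<Rightarrow> real) \<Rightarrow> ('x \<Rightarrow> 'x \<Rightarrow> real) \<Rightarrow> 'x \<Rightarrow> real" where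
  "kernel_div K \<Psi> x = 1/2 * (\<Sum>y\<in>UNIV. (\<Psi> x y - \<Psi> y x) * K x y)"


section \<open>Absolutely continuous curves and the continuity equation with source\<close>

text \<open>
  The usual epsilon-delta definition, for subsets of the real line. The members of a division
  are nonempty compact intervals with pairwise disjoint interiors, so \<open>Inf k\<close> and
  \<open>Sup k\<close> are the endpoints of \<open>k\<close>.
\<close>

definition abs_continuous_on :: "real set \<Rightarrow> (real \<Rightarrow> real) \<Rightarrow> bool" where
  "abs_continuous_on S f \<longleftrightarrow>
     (\<forall>\<epsilon>>0. \<exists>\<delta>>0. \<forall>d. d division_of \<Union>d \<and> \<Union>d \<subseteq> S \<and> (\<Sum>k\<in>d. Sup k - Inf k) < \<delta>
        \<longrightarrow> (\<Sum>k\<in>d. \<bar>f (Sup k) - f (Inf k)\<bar>) < \<epsilon>)"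

definition abs_continuous_curve :: "(real \<Rightarrow> 'x::finite \<Rightarrow> real) \<Rightarrow> bool" where
  "abs_continuous_curve \<mu> \<longleftrightarrow> (\<forall>x. abs_continuous_on {0..1} (\<lambda>t. \<mu> t x))"

text \<open>
  \<open>\<mu>'\<^sub>t + div V\<^sub>t = h\<^sub>t p\<close> for almost every \<open>t\<close> in the unit interval. Curves are functions on the
  whole real line, but only their values on the unit interval matter.
\<close>

definition continuity_equation ::
  "('x::finite \<Rightarrow> 'x \<Rightarrow> real) \<Rightarrow> ('x \<Rightarrow> real) \<Rightarrow> (real \<Rightarrow> 'x \<Rightarrow> real) \<Rightarrow> (real \<Rightarrow> 'x \<Rightarrow> 'x \<Rightarrow> real)
     \<Rightarrow> (real \<Rightarrow> real) \<Rightarrow> bool" where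
  "continuity_equation K p \<mu> V h \<longleftrightarrow>
     (AE t in lebesgue_on {0..1}. \<forall>x. \<exists>D.
        ((\<lambda>s. \<mu> s x) has_real_derivative D) (at t within {0..1}) \<and>
        D + kernel_div K (V t) x = h t * p x)"

definition CE ::
  "('x::finite \<Rightarrow> 'x \<Rightarrow> real) \<Rightarrow> ('x \<Rightarrow> real) \<Rightarrow> ('x \<Rightarrow> real) \<Rightarrow> ('x \<Rightarrow> real)
     \<Rightarrow> ((real \<Rightarrow> 'x \<Rightarrow> real) \<times> (real \<Rightarrow> 'x \<Rightarrow> 'x \<Rightarrow> real) \<times> (real \<Rightarrow> real)) set" where
  "CE K p \<mu>\<^sub>0 \<mu>\<^sub>1 = {(\<mu>, V, h).
     (\<forall>t\<in>{0..1}. \<mu> t \<in> nonneg_densities) \<and>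
     abs_continuous_curve \<mu> \<and> \<mu> 0 = \<mu>\<^sub>0 \<and> \<mu> 1 = \<mu>\<^sub>1 \<and>
     (\<forall>x y. (\<lambda>t. V t x y) \<in> borel_measurable (lebesgue_on {0..1})) \<and>
     h \<in> borel_measurable (lebesgue_on {0..1}) \<and>
     continuity_equation K p \<mu> V h}"


section \<open>The energy\<close>

text \<open>
  Since \<open>0 powr \<xi> = 0\<close> for every \<open>\<xi>\<close>, the integrand vanishes if \<open>u = 0\<close> or \<open>v = 0\<close>.
\<close>

definition log_mean :: "real \<Rightarrow> real \<Rightarrow> real" where
  "log_mean u v = integral {0..1} (\<lambda>\<xi>. u powr \<xi> * v powr (1 - \<xi>))"

definition action_density :: "real \<Rightarrow> real \<Rightarrow> real \<Rightarrow> ennreal" where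
  "action_density v s t =
     (if log_mean s t = 0 then (if v = 0 then 0 else \<infinity>) else ennreal (v\<^sup>2 / log_mean s t))"

text \<open>In \<^typ>\<open>ennreal\<close>, the product of \<open>0\<close> and \<open>\<infinity>\<close> is \<open>0\<close>.\<close>

definition action ::
  "('x::finite \<Rightarrow> 'x \<Rightarrow> real) \<Rightarrow> ('x \<Rightarrow> real) \<Rightarrow> ('x \<Rightarrow> real) \<Rightarrow> ('x \<Rightarrow> 'x \<Rightarrow> real) \<Rightarrow> ennreal" where
  "action K \<pi> \<mu> V = ennreal (1/2) *
     (\<Sum>x\<in>UNIV. \<Sum>y\<in>UNIV. action_density (V x y) (\<mu> x) (\<mu> y) * ennreal (K x y * \<pi> x))"

definition energy_quad ::
  "('x::finite \<Rightarrow> 'x \<Rightarrow> real) \<Rightarrow> ('x \<Rightarrow> real) \<Rightarrow> real \<Rightarrow> real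
     \<Rightarrow> (real \<Rightarrow> 'x \<Rightarrow> real) \<times> (real \<Rightarrow> 'x \<Rightarrow> 'x \<Rightarrow> real) \<times> (real \<Rightarrow> real) \<Rightarrow> ennreal" where
  "energy_quad K \<pi> a b = (\<lambda>(\<mu>, V, h).
     ennreal (a\<^sup>2) * (\<integral>\<^sup>+t. ennreal (\<bar>h t\<bar>\<^sup>2) \<partial>lebesgue_on {0..1}) +
     ennreal (b\<^sup>2) * (\<integral>\<^sup>+t. action K \<pi> (\<mu> t) (V t) \<partial>lebesgue_on {0..1}))"


section \<open>Decreasing rearrangement\<close>

definition superlevel_measure :: "(real \<Rightarrow> real) \<Rightarrow> real \<Rightarrow> real" where
  "superlevel_measure f \<alpha> = measure lebesgue {t \<in> {0..1}. f t > \<alpha>}"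

text \<open>
  Meaningful for \<open>0 < u < 1\<close> only: at the endpoints the infimum may be taken over an empty or
  unbounded set and is then an unspecified real number. This affects only a null set of times.
\<close>

definition decreasing_rearrangement :: "(real \<Rightarrow> real) \<Rightarrow> real \<Rightarrow> real" where
  "decreasing_rearrangement f u = Inf {\<alpha>. superlevel_measure f \<alpha> \<le> u}"


section \<open>The initial value problem\<close>

definition solves_continuity_ivp ::
  "('x::finite \<Rightarrow> 'x \<Rightarrow> real) \<Rightarrow> ('x \<Rightarrow> real) \<Rightarrow> ('x \<Rightarrow> real) \<Rightarrow> (real \<Rightarrow> 'x \<Rightarrow> 'x \<Rightarrow> real)
     \<Rightarrow> (real \<Rightarrow> real) \<Rightarrow> (real \<Rightarrow> 'x \<Rightarrow> real) \<Rightarrow> bool" where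
  "solves_continuity_ivp K p \<mu>\<^sub>0 V h \<nu> \<longleftrightarrow>
     abs_continuous_curve \<nu> \<and> \<nu> 0 = \<mu>\<^sub>0 \<and> continuity_equation K p \<nu> V h"

end

theory Submission
  imports Defs "HOL-Probability.Weak_Convergence"
begin

text \<open>
  Let \<open>h*\<close> be the decreasing rearrangement of \<open>h\<close>. The flux \<open>V\<close> is kept, so the new curve can only
  differ from \<open>\<mu>\<close> by the source terms: \<open>\<nu>\<^sub>t = \<mu>\<^sub>t + p W\<^sub>t\<close> with
  \<open>W\<^sub>t = \<integral>\<^sub>0\<^sup>t (h* - h)\<close>. Among all rearrangements of \<open>h\<close>, the decreasing one makes the integral
  over an initial interval largest, hence \<open>W \<ge> 0\<close>, and \<open>W\<^sub>1 = 0\<close> because \<open>h\<close> and \<open>h*\<close> have the same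
  distribution. Therefore \<open>\<nu> \<ge> \<mu> \<ge> 0\<close> with the same endpoints. The logarithmic mean is monotone in
  both arguments, so the action of \<open>(\<nu>, V)\<close> is at most that of \<open>(\<mu>, V)\<close>, while the source costs
  \<open>\<integral> h\<^sup>2\<close> and \<open>\<integral> h*\<^sup>2\<close> agree by equimeasurability.
  
  The analytic input is the Lebesgue fundamental theorem of calculus. By reversibility the divergence
  carries no total mass, so \<open>h\<close> is almost everywhere the derivative of the absolutely continuous
  mass \<open>t \<mapsto> \<Sum>\<^sub>x \<mu>\<^sub>t(x) \<pi>(x)\<close>. Hence \<open>h\<close> is integrable and the mass is its primitive
  (\<open>abs_continuous_absolutely_integrable\<close>, \<open>abs_continuous_has_integral\<close>). The second of these
  also gives uniqueness for the initial value problem. In the other direction,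
  \<open>abs_continuous_on_indefinite_integral\<close> and
  \<open>decreasing_rearrangement_primitive_has_derivative\<close> show that \<open>\<nu>\<close> is absolutely continuous and
  satisfies the continuity equation.
  
  The comparison of initial integrals is \<open>integral_le_integral_decreasing_rearrangement\<close>; it rests
  on \<open>distr_decreasing_rearrangement\<close>, the equality of the two distributions.
\<close>

section \<open>Absolute continuity and the fundamental theorem of calculus\<close>

lemma abs_continuous_on_subset:
  assumes "abs_continuous_on S f" "T \<subseteq> S"
  shows "abs_continuous_on T f"
  using assms unfolding abs_continuous_on_def by (meson subset_trans)

lemma abs_continuous_onE:
  assumes "abs_continuous_on S f" "\<epsilon> > 0"
  obtains \<delta> where "\<delta> > 0"
    "\<And>d. d division_of \<Union>d \<Longrightarrow> \<Union>d \<subseteq> S \<Longrightarrow> (\<Sum>k\<in>d. Sup k - Inf k) < \<delta>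
        \<Longrightarrow> (\<Sum>k\<in>d. \<bar>f (Sup k) - f (Inf k)\<bar>) < \<epsilon>"
proof -
  have "\<exists>\<delta>>0. \<forall>d. d division_of \<Union>d \<and> \<Union>d \<subseteq> S \<and> (\<Sum>k\<in>d. Sup k - Inf k) < \<delta>
      \<longrightarrow> (\<Sum>k\<in>d. \<bar>f (Sup k) - f (Inf k)\<bar>) < \<epsilon>"
    using assms(1)[unfolded abs_continuous_on_def, rule_format, OF assms(2)] .
  then show ?thesis using that by blast
qed

lemma abs_continuous_on_add:
  assumes "abs_continuous_on S f" "abs_continuous_on S g"
  shows "abs_continuous_on S (\<lambda>t. f t + g t)"
  unfolding abs_continuous_on_def
proof (intro allI impI)
  fix \<epsilon> :: real assume "\<epsilon> > 0"
  then have half: "\<epsilon> / 2 > 0" by simp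
  obtain \<delta>1 where \<delta>1: "\<delta>1 > 0"
    and f: "\<And>d. d division_of \<Union>d \<Longrightarrow> \<Union>d \<subseteq> S \<Longrightarrow> (\<Sum>k\<in>d. Sup k - Inf k) < \<delta>1
        \<Longrightarrow> (\<Sum>k\<in>d. \<bar>f (Sup k) - f (Inf k)\<bar>) < \<epsilon> / 2"
    using abs_continuous_onE[OF assms(1) half] by blast
  obtain \<delta>2 where \<delta>2: "\<delta>2 > 0"
    and g: "\<And>d. d division_of \<Union>d \<Longrightarrow> \<Union>d \<subseteq> S \<Longrightarrow> (\<Sum>k\<in>d. Sup k - Inf k) < \<delta>2
        \<Longrightarrow> (\<Sum>k\<in>d. \<bar>g (Sup k) - g (Inf k)\<bar>) < \<epsilon> / 2"
    using abs_continuous_onE[OF assms(2) half] by blast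
  show "\<exists>\<delta>>0. \<forall>d. d division_of \<Union>d \<and> \<Union>d \<subseteq> S \<and> (\<Sum>k\<in>d. Sup k - Inf k) < \<delta>
      \<longrightarrow> (\<Sum>k\<in>d. \<bar>f (Sup k) + g (Sup k) - (f (Inf k) + g (Inf k))\<bar>) < \<epsilon>"
  proof (intro exI[of _ "min \<delta>1 \<delta>2"] conjI allI impI)
    fix d assume d: "d division_of \<Union>d \<and> \<Union>d \<subseteq> S \<and> (\<Sum>k\<in>d. Sup k - Inf k) < min \<delta>1 \<delta>2"
    have "(\<Sum>k\<in>d. \<bar>f (Sup k) + g (Sup k) - (f (Inf k) + g (Inf k))\<bar>)
        \<le> (\<Sum>k\<in>d. \<bar>f (Sup k) - f (Inf k)\<bar>) + (\<Sum>k\<in>d. \<bar>g (Sup k) - g (Inf k)\<bar>)"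
      unfolding sum.distrib[symmetric] by (rule sum_mono) auto
    also have "\<dots> < \<epsilon>" using f[of d] g[of d] d by simp
    finally show "(\<Sum>k\<in>d. \<bar>f (Sup k) + g (Sup k) - (f (Inf k) + g (Inf k))\<bar>) < \<epsilon>" .
  qed (use \<delta>1 \<delta>2 in auto)
qed

lemma abs_continuous_on_cmult:
  assumes "abs_continuous_on S f"
  shows "abs_continuous_on S (\<lambda>t. c * f t)"
  unfolding abs_continuous_on_def
proof (intro allI impI)
  fix \<epsilon> :: real assume "\<epsilon> > 0"
  then have pos: "\<epsilon> / (\<bar>c\<bar> + 1) > 0" by (simp add: add_nonneg_pos)
  obtain \<delta> where \<delta>: "\<delta> > 0"
    and f: "\<And>d. d division_of \<Union>d \<Longrightarrow> \<Union>d \<subseteq> S \<Longrightarrow> (\<Sum>k\<in>d. Sup k - Inf k) < \<delta>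
        \<Longrightarrow> (\<Sum>k\<in>d. \<bar>f (Sup k) - f (Inf k)\<bar>) < \<epsilon> / (\<bar>c\<bar> + 1)"
    using abs_continuous_onE[OF assms pos] by blast
  show "\<exists>\<delta>>0. \<forall>d. d division_of \<Union>d \<and> \<Union>d \<subseteq> S \<and> (\<Sum>k\<in>d. Sup k - Inf k) < \<delta>
      \<longrightarrow> (\<Sum>k\<in>d. \<bar>c * f (Sup k) - c * f (Inf k)\<bar>) < \<epsilon>"
  proof (intro exI[of _ \<delta>] conjI allI impI \<delta>)
    fix d assume d: "d division_of \<Union>d \<and> \<Union>d \<subseteq> S \<and> (\<Sum>k\<in>d. Sup k - Inf k) < \<delta>"
    let ?v = "\<Sum>k\<in>d. \<bar>f (Sup k) - f (Inf k)\<bar>"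
    have "(\<Sum>k\<in>d. \<bar>c * f (Sup k) - c * f (Inf k)\<bar>) = \<bar>c\<bar> * ?v"
      by (simp add: sum_distrib_left abs_mult flip: right_diff_distrib)
    also have "\<dots> \<le> (\<bar>c\<bar> + 1) * ?v"
      by (intro mult_right_mono sum_nonneg) auto
    also have "\<dots> < \<epsilon>"
      using f[of d] d pos_less_divide_eq[of "\<bar>c\<bar> + 1" ?v \<epsilon>] by (simp only: mult.commute)
    finally show "(\<Sum>k\<in>d. \<bar>c * f (Sup k) - c * f (Inf k)\<bar>) < \<epsilon>" .
  qed
qed

lemma abs_continuous_on_const: "abs_continuous_on S (\<lambda>t. c)"
  by (simp add: abs_continuous_on_def gt_ex)

lemma abs_continuous_on_sum:
  assumes "\<And>i. i \<in> I \<Longrightarrow> abs_continuous_on S (f i)"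
  shows "abs_continuous_on S (\<lambda>t. \<Sum>i\<in>I. f i t)"
  using assms
  by (induction I rule: infinite_finite_induct)
     (auto intro: abs_continuous_on_add abs_continuous_on_const)

text \<open>
  The lengths in the definition of absolute continuity become a Lebesgue measure, which outer
  regularity and monotonicity of measure can bound.
\<close>

lemma division_length_eq_measure:
  fixes d :: "real set set"
  assumes d: "d division_of S"
  shows "(\<Sum>k\<in>d. Sup k - Inf k) = measure lebesgue S"
proof -
  have len: "Sup k - Inf k = measure lborel k" "((\<lambda>x. 1) has_integral measure lborel k) k" if kd: "k \<in> d" for k
  proof -
    obtain u v where k: "k = cbox u v" and ne: "k \<noteq> {}"
      using division_ofD(3,4)[OF d kd] by blast
    then have "u \<le> v" by auto
    with k show "Sup k - Inf k = measure lborel k" by simp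
    show "((\<lambda>x. 1) has_integral measure lborel k) k"
      using has_integral_const[of "1::real" u v] k by simp
  qed
  have "((\<lambda>x. 1) has_integral (\<Sum>k\<in>d. measure lborel k)) S"
    using has_integral_combine_division[OF d] len by blast
  then have "measure lebesgue S = (\<Sum>k\<in>d. measure lborel k)"
    using lmeasure_integral[of S] lmeasurable_iff_integrable_on[of S] by (simp add: has_integral_iff)
  with len show ?thesis by simp
qed

text \<open>
  The Henstock-Kurzweil integral lets absolute continuity act directly, without a covering theorem.
  Put \<open>f' = 0\<close> on the exceptional set \<open>N\<close> and choose the gauge in two ways. At a tag outside \<open>N\<close>
  it enforces the usual straddle estimate. At a tag in \<open>N\<close> it confines the interval to an open
  \<open>T \<supseteq> N\<close> of measure less than \<open>\<delta>\<close>. The intervals tagged in \<open>N\<close> then have total length less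
  than \<open>\<delta>\<close>, so the increments of \<open>f\<close> over them have a small sum by absolute continuity.
\<close>

lemma abs_continuous_has_integral:
  fixes f f' :: "real \<Rightarrow> real"
  assumes "a \<le> b" and ac: "abs_continuous_on {a..b} f" and "negligible N"
    and der: "\<And>x. x \<in> {a..b} - N \<Longrightarrow> (f has_real_derivative f' x) (at x within {a..b})"
  shows "(f' has_integral (f b - f a)) {a..b}"
proof (cases "a = b")
  case True
  then show ?thesis by auto
next
  case False
  with \<open>a \<le> b\<close> have "a < b" by simp
  define g where "g x = (if x \<in> N then 0 else f' x)" for x
  have "(g has_integral (f b - f a)) (cbox a b)"
    unfolding has_integral_factor_content
  proof (intro allI impI)
    fix e :: real assume "e > 0"
    \<comment> \<open>Half of the admissible error \<open>e * (b - a)\<close> goes to the intervals tagged in \<open>N\<close>, half to the others.\<close>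
    define \<epsilon> where "\<epsilon> = e * (b - a) / 2"
    have "\<epsilon> > 0" using \<open>e > 0\<close> \<open>a < b\<close> by (simp add: \<epsilon>_def)
    then obtain \<delta> where "\<delta> > 0" and \<delta>: "\<And>d. d division_of \<Union>d \<Longrightarrow> \<Union>d \<subseteq> {a..b} \<Longrightarrow>
        (\<Sum>k\<in>d. Sup k - Inf k) < \<delta> \<Longrightarrow> (\<Sum>k\<in>d. \<bar>f (Sup k) - f (Inf k)\<bar>) < \<epsilon>"
      using abs_continuous_onE[OF ac \<open>\<epsilon> > 0\<close>] by blast
    have N: "N \<in> null_sets lebesgue"
      using \<open>negligible N\<close> by (simp add: negligible_iff_null_sets)
    then obtain T where T: "open T" "N \<subseteq> T" "T - N \<in> lmeasurable" "emeasure lebesgue (T - N) < ennreal \<delta>"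
      using sets_lebesgue_outer_open[of N \<delta>] \<open>\<delta> > 0\<close> by blast
    have T': "emeasure lebesgue T < ennreal \<delta>"
      using T N by (metis Un_Diff_cancel2 emeasure_Un_null_set fmeasurableD sup.absorb1)
    have "\<forall>x. \<exists>r>0. (x \<in> {a..b} - N \<longrightarrow>
         (\<forall>y\<in>{a..b}. norm (y-x) < r \<longrightarrow> norm (f y - f x - (y-x) *\<^sub>R g x) \<le> e/2 * norm (y-x)))"
    proof
      fix x
      show "\<exists>r>0. (x \<in> {a..b} - N \<longrightarrow>
         (\<forall>y\<in>{a..b}. norm (y-x) < r \<longrightarrow> norm (f y - f x - (y-x) *\<^sub>R g x) \<le> e/2 * norm (y-x)))"
      proof (cases "x \<in> {a..b} - N")
        case True
        then have "(f has_vector_derivative g x) (at x within {a..b})"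
          using der by (simp add: g_def has_real_derivative_iff_has_vector_derivative)
        then show ?thesis
          using \<open>e > 0\<close> half_gt_zero unfolding has_vector_derivative_def has_derivative_within_alt by blast
      next
        case False
        then show ?thesis by (intro exI[of _ 1]) auto
      qed
    qed
    then obtain r where r: "\<And>x. 0 < r x"
      "\<And>x y. \<lbrakk>x \<in> {a..b} - N; y \<in> {a..b}; norm (y-x) < r x\<rbrakk>
          \<Longrightarrow> norm (f y - f x - (y-x) *\<^sub>R g x) \<le> e/2 * norm (y-x)"
      by metis
    have "\<forall>x. \<exists>r>0. x \<in> N \<longrightarrow> ball x r \<subseteq> T"
      using T(1,2) by (metis openE subsetD zero_less_one)
    then obtain s where s: "\<And>x. 0 < s x" "\<And>x. x \<in> N \<Longrightarrow> ball x (s x) \<subseteq> T"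
      by metis
    define \<gamma> where "\<gamma> x = ball x (if x \<in> N then s x else r x)" for x
    show "\<exists>\<gamma>. gauge \<gamma> \<and> (\<forall>D. D tagged_division_of cbox a b \<and> \<gamma> fine D \<longrightarrow>
        norm ((\<Sum>(x, k)\<in>D. measure lborel k *\<^sub>R g x) - (f b - f a)) \<le> e * measure lborel (cbox a b))"
    proof (intro exI[of _ \<gamma>] conjI allI impI)
      show "gauge \<gamma>" unfolding \<gamma>_def by (rule gauge_ball_dependent) (use r s in auto)
    next
      fix D assume "D tagged_division_of cbox a b \<and> \<gamma> fine D"
      then have D: "D tagged_division_of cbox a b" and fine: "\<gamma> fine D" by auto
      note Dd = tagged_division_ofD[OF D]
      have fin: "finite D" using D by blast
      have shape: "\<exists>u v. K = {u..v} \<and> u \<le> v \<and> x \<in> {u..v} \<and> {u..v} \<subseteq> {a..b} \<and> {u..v} \<subseteq> \<gamma> x"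
        if "(x, K) \<in> D" for x K
      proof -
        obtain u v where K: "K = cbox u v" using Dd(4)[OF \<open>(x, K) \<in> D\<close>] by blast
        have "x \<in> K" "K \<subseteq> cbox a b" "K \<subseteq> \<gamma> x"
          using Dd that fine by (auto simp: fine_def)
        then show ?thesis using K by auto
      qed
      define \<Delta> where "\<Delta> = (\<lambda>(x::real, K). measure lborel K *\<^sub>R g x - (f (Sup K) - f (Inf K)))"
      define B where "B = {(x, K) \<in> D. x \<in> N}"
      have B: "B \<subseteq> D" "finite B" using fin by (auto simp: B_def intro: finite_subset[OF _ fin])
      have "norm ((\<Sum>(x, k)\<in>D. measure lborel k *\<^sub>R g x) - (f b - f a)) = norm (sum \<Delta> D)"
        using additive_tagged_division_1[where f= f and a=a and b=b, OF \<open>a \<le> b\<close>] D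
        by (simp add: \<Delta>_def split_def sum_subtractf)
      also have "\<dots> \<le> norm (sum \<Delta> (D - B)) + norm (sum \<Delta> B)"
        unfolding sum.subset_diff[OF B(1) fin] by (rule norm_triangle_ineq)
      also have "norm (sum \<Delta> (D - B)) \<le> (\<Sum>(x, K)\<in>D - B. e/2 * measure lborel K)"
      proof (rule sum_norm_le, safe)
        fix x K assume xK: "(x, K) \<in> D" "(x, K) \<notin> B"
        then obtain u v where K: "K = {u..v}" "u \<le> v" "x \<in> {u..v}" "{u..v} \<subseteq> {a..b}" "{u..v} \<subseteq> \<gamma> x"
          using shape by blast
        have x: "x \<in> {a..b} - N" using xK K by (auto simp: B_def)
        have b: "norm (f y - f x - (y-x) *\<^sub>R g x) \<le> e/2 * norm (y-x)" if "y \<in> {u..v}" for y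
        proof (rule r(2)[OF x])
          show "y \<in> {a..b}" using K that by auto
          have "y \<in> \<gamma> x" using K(5) that by auto
          then show "norm (y - x) < r x"
            using x by (auto simp: \<gamma>_def dist_real_def)
        qed
        have "norm (\<Delta> (x, K)) = norm ((f u - f x - (u-x) *\<^sub>R g x) - (f v - f x - (v-x) *\<^sub>R g x))"
          using K by (simp add: \<Delta>_def algebra_simps)
        also have "\<dots> \<le> e/2 * norm (u - x) + e/2 * norm (v - x)"
          by (rule order_trans[OF norm_triangle_ineq4 add_mono[OF b b]]) (use K(2) in auto)
        also have "\<dots> = e/2 * measure lborel K"
          using K by (simp add: field_simps)
        finally show "norm (\<Delta> (x, K)) \<le> e/2 * measure lborel K" .
      qed
      also have "(\<Sum>(x, K)\<in>D - B. e/2 * measure lborel K) \<le> (\<Sum>(x, K)\<in>D. e/2 * measure lborel K)"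
        using \<open>e > 0\<close> by (intro sum_mono2 fin) auto
      also have "\<dots> = e/2 * (b - a)"
        using additive_content_tagged_division[OF D] \<open>a \<le> b\<close>
        by (simp add: split_def flip: sum_distrib_left sum_divide_distrib)
      also have "norm (sum \<Delta> B) \<le> \<epsilon>"
      proof -
        define d where "d = snd ` B"
        have Bp: "B tagged_partial_division_of cbox a b"
          by (rule tagged_partial_division_subset[OF _ B(1)]) (use D in \<open>simp add: tagged_division_of_def\<close>)
        have d: "d division_of \<Union>d"
          unfolding d_def by (rule partial_division_of_tagged_division[OF Bp])
        have "\<Union>d \<subseteq> T"
        proof safe
          fix y K assume "y \<in> K" "K \<in> d"
          then obtain x where "(x, K) \<in> D" "x \<in> N" by (auto simp: d_def B_def)
          with shape[of x K] s(2)[of x] \<open>y \<in> K\<close> show "y \<in> T" by (auto simp: \<gamma>_def)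
        qed
        then have "emeasure lebesgue (\<Union>d) \<le> emeasure lebesgue T"
          using T(1) by (intro emeasure_mono) auto
        then have "emeasure lebesgue (\<Union>d) < ennreal \<delta>"
          using T' by (rule le_less_trans)
        moreover from this have "emeasure lebesgue (\<Union>d) = ennreal (measure lebesgue (\<Union>d))"
          by (intro emeasure_eq_ennreal_measure) auto
        ultimately have "(\<Sum>k\<in>d. Sup k - Inf k) < \<delta>"
          unfolding division_length_eq_measure[OF d] by (simp add: ennreal_less_iff)
        moreover have "\<Union>d \<subseteq> {a..b}"
          using shape B(1) by (force simp: d_def)
        ultimately have "(\<Sum>k\<in>d. \<bar>f (Sup k) - f (Inf k)\<bar>) < \<epsilon>"
          using \<delta> d by blast
        \<comment> \<open>The case distinction gives the value \<open>0\<close> at the empty interval, where \<open>Sup\<close> and \<open>Inf\<close> are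
            unspecified; passing from tagged intervals to their set of intervals needs it.\<close>
        moreover have "norm (sum \<Delta> B) \<le> (\<Sum>(x, K)\<in>B. if K = {} then 0 else \<bar>f (Sup K) - f (Inf K)\<bar>)"
        proof (rule sum_norm_le, safe)
          fix x K assume "(x, K) \<in> B"
          then show "norm (\<Delta> (x, K)) \<le> (if K = {} then 0 else \<bar>f (Sup K) - f (Inf K)\<bar>)"
            using shape[of x K] B(1) by (auto simp: \<Delta>_def g_def B_def)
        qed
        moreover have "(\<Sum>(x, K)\<in>B. if K = {} then 0 else \<bar>f (Sup K) - f (Inf K)\<bar>)
             = (\<Sum>K\<in>d. if K = {} then 0 else \<bar>f (Sup K) - f (Inf K)\<bar>)"
          unfolding d_def
          by (rule sum.over_tagged_division_lemma[OF tagged_partial_division_of_Union_self[OF Bp]])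
             (auto simp: box_real)
        moreover have "\<dots> = (\<Sum>K\<in>d. \<bar>f (Sup K) - f (Inf K)\<bar>)"
          using division_ofD(3)[OF d] by (intro sum.cong) auto
        ultimately show ?thesis by linarith
      qed
      finally show "norm ((\<Sum>(x, k)\<in>D. measure lborel k *\<^sub>R g x) - (f b - f a)) \<le> e * measure lborel (cbox a b)"
        using \<open>a \<le> b\<close> by (simp add: \<epsilon>_def field_simps)
    qed
  qed
  then have "(g has_integral (f b - f a)) {a..b}" by simp
  then show ?thesis
    by (rule has_integral_spike[OF \<open>negligible N\<close>, rotated]) (simp add: g_def)
qed

text \<open>
  On an interval shorter than \<open>\<delta>\<close> the sums of \<open>\<bar>f v - f u\<bar>\<close>, which are the sums of
  \<open>\<bar>\<integral> f'\<bar>\<close> over the members of a division, stay below \<open>1\<close>. A Henstock-Kurzweil integrable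
  function whose indefinite integral has bounded variation is absolutely integrable, and finitely
  many such intervals cover \<open>{a..b}\<close>.
\<close>

lemma abs_continuous_absolutely_integrable:
  fixes f f' :: "real \<Rightarrow> real"
  assumes "a \<le> b" and ac: "abs_continuous_on {a..b} f" and neg: "negligible N"
    and der: "\<And>x. x \<in> {a..b} - N \<Longrightarrow> (f has_real_derivative f' x) (at x within {a..b})"
  shows "f' absolutely_integrable_on {a..b}"
proof -
  have FTC: "(f' has_integral (f v - f u)) {u..v}" if "a \<le> u" "u \<le> v" "v \<le> b" for u v
  proof (rule abs_continuous_has_integral[OF \<open>u \<le> v\<close> _ neg])
    show "abs_continuous_on {u..v} f"
      using ac by (rule abs_continuous_on_subset) (use that in auto)
    show "(f has_real_derivative f' x) (at x within {u..v})" if "x \<in> {u..v} - N" for x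
      using der[of x] that \<open>a \<le> u\<close> \<open>v \<le> b\<close> by (auto intro: has_field_derivative_subset)
  qed
  obtain \<delta> where "\<delta> > 0" and \<delta>: "\<And>d. d division_of \<Union>d \<Longrightarrow> \<Union>d \<subseteq> {a..b} \<Longrightarrow>
        (\<Sum>k\<in>d. Sup k - Inf k) < \<delta> \<Longrightarrow> (\<Sum>k\<in>d. \<bar>f (Sup k) - f (Inf k)\<bar>) < 1"
    using abs_continuous_onE[OF ac zero_less_one] by blast
  have short: "f' absolutely_integrable_on {u..v}" if uv: "a \<le> u" "u \<le> v" "v \<le> b" "v - u < \<delta>" for u v
    unfolding box_real(2)[symmetric]
  proof (rule bounded_variation_absolutely_integrable_interval)
    show "f' integrable_on cbox u v" using FTC[OF uv(1-3)] by auto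
    fix d assume d: "d division_of cbox u v"
    have Un: "\<Union>d = {u..v}" using division_ofD(6)[OF d] by simp
    then have "(\<Sum>k\<in>d. Sup k - Inf k) < \<delta>"
      using division_length_eq_measure[OF d] uv by simp
    then have "(\<Sum>k\<in>d. \<bar>f (Sup k) - f (Inf k)\<bar>) < 1"
      using \<delta>[of d] d Un uv by auto
    moreover have "norm (integral k f') = \<bar>f (Sup k) - f (Inf k)\<bar>" if k: "k \<in> d" for k
    proof -
      obtain u' v' where k': "k = cbox u' v'" "k \<noteq> {}" "k \<subseteq> cbox u v"
        using division_ofD(2,3,4)[OF d k] by blast
      then have "integral {u'..v'} f' = f v' - f u'"
        using uv by (intro integral_unique FTC) auto
      with k' show ?thesis by auto
    qed
    ultimately show "(\<Sum>k\<in>d. norm (integral k f')) \<le> 1" by simp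
  qed
  define \<eta> where "\<eta> = \<delta> / 2"
  have \<eta>: "0 < \<eta>" "\<eta> < \<delta>" using \<open>\<delta> > 0\<close> by (auto simp: \<eta>_def)
  have "f' absolutely_integrable_on {a..min b (a + real n * \<eta>)}" for n
  proof (induction n)
    case 0
    then show ?case using \<open>a \<le> b\<close> by (intro short) (use \<open>\<delta> > 0\<close> in auto)
  next
    case (Suc n)
    have "0 \<le> real n * \<eta>" using \<eta> by simp
    moreover have "real (Suc n) * \<eta> = real n * \<eta> + \<eta>" by (simp add: algebra_simps)
    ultimately show ?case
      using \<eta> \<open>a \<le> b\<close>
      by (intro absolutely_integrable_on_combine[OF Suc.IH short]) linarith+
  qed
  moreover obtain n where "b - a < real n * \<eta>"
    using reals_Archimedean3[OF \<eta>(1)] by blast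
  then have "min b (a + real n * \<eta>) = b" by simp
  ultimately show ?thesis by metis
qed

text \<open>
  Truncate \<open>\<bar>g\<bar>\<close> at height \<open>n\<close>. By dominated convergence the remainder has integral below
  \<open>\<epsilon>/2\<close> for some \<open>n\<close>, and the truncated part contributes at most \<open>n\<close> times the total length.
\<close>

lemma abs_continuous_on_indefinite_integral:
  fixes g :: "real \<Rightarrow> real"
  assumes g: "g absolutely_integrable_on {a..b}"
  shows "abs_continuous_on {a..b} (\<lambda>t. integral {a..t} g)"
  unfolding abs_continuous_on_def
proof (intro allI impI)
  fix \<epsilon> :: real assume "\<epsilon> > 0"
  let ?h = "\<lambda>n x. min \<bar>g x\<bar> (real n)"
  have abs: "(\<lambda>x. \<bar>g x\<bar>) absolutely_integrable_on {a..b}"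
    using absolutely_integrable_abs[OF g] by simp
  have h: "?h n absolutely_integrable_on {a..b}" for n
    by (rule absolutely_integrable_min_1[OF abs]) auto
  have int_h: "?h n integrable_on {a..b}" for n
    using h by (rule set_lebesgue_integral_eq_integral)
  have int_abs: "(\<lambda>x. \<bar>g x\<bar>) integrable_on {a..b}"
    using abs by (rule set_lebesgue_integral_eq_integral)
  have "(\<lambda>n. integral {a..b} (?h n)) \<longlonglongrightarrow> integral {a..b} (\<lambda>x. \<bar>g x\<bar>)"
  proof (rule dominated_convergence(2)[OF int_h int_abs])
    fix x
    have "eventually (\<lambda>n. \<bar>g x\<bar> \<le> real n) sequentially"
      using eventually_ge_at_top[of "nat \<lceil>\<bar>g x\<bar>\<rceil>"] by eventually_elim linarith
    then have "eventually (\<lambda>n. ?h n x = \<bar>g x\<bar>) sequentially"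
      by eventually_elim simp
    then show "(\<lambda>n. ?h n x) \<longlonglongrightarrow> \<bar>g x\<bar>" by (rule tendsto_eventually)
  qed auto
  then have "eventually (\<lambda>n. integral {a..b} (?h n) > integral {a..b} (\<lambda>x. \<bar>g x\<bar>) - \<epsilon> / 2) sequentially"
    by (rule order_tendstoD) (use \<open>\<epsilon> > 0\<close> in simp)
  then obtain n where n: "integral {a..b} (?h n) > integral {a..b} (\<lambda>x. \<bar>g x\<bar>) - \<epsilon> / 2"
    by (auto simp: eventually_sequentially)
  let ?r = "\<lambda>x. \<bar>g x\<bar> - ?h n x"
  have int_r: "?r integrable_on {a..b}"
    by (rule integrable_diff[OF int_abs int_h])
  have small: "integral {a..b} ?r < \<epsilon> / 2"
    using n by (simp add: integral_diff[OF int_abs int_h])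
  define \<delta> where "\<delta> = \<epsilon> / (2 * (real n + 1))"
  have "\<delta> > 0" using \<open>\<epsilon> > 0\<close> by (simp add: \<delta>_def)
  have n\<delta>: "real n * \<delta> \<le> \<epsilon> / 2" using \<open>\<epsilon> > 0\<close> by (simp add: \<delta>_def field_simps)
  show "\<exists>\<delta>>0. \<forall>d. d division_of \<Union>d \<and> \<Union>d \<subseteq> {a..b} \<and> (\<Sum>k\<in>d. Sup k - Inf k) < \<delta> \<longrightarrow>
      (\<Sum>k\<in>d. \<bar>integral {a..Sup k} g - integral {a..Inf k} g\<bar>) < \<epsilon>"
  proof (intro exI[of _ \<delta>] conjI allI impI \<open>\<delta> > 0\<close>, elim conjE)
    fix d assume d: "d division_of \<Union>d" and sub: "\<Union>d \<subseteq> {a..b}" and len: "(\<Sum>k\<in>d. Sup k - Inf k) < \<delta>"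
    have bound: "\<bar>integral {a..Sup k} g - integral {a..Inf k} g\<bar> \<le> integral k ?r + real n * (Sup k - Inf k)"
      if k: "k \<in> d" for k
    proof -
      obtain u v where "k = cbox u v" "k \<noteq> {}" "k \<subseteq> \<Union>d"
        using division_ofD(2,3,4)[OF d k] by blast
      then have k': "k = {u..v}" "u \<le> v" and s: "{u..v} \<subseteq> {a..b}"
        using subset_trans[OF _ sub, of k] by auto
      then have uv: "k = {u..v}" "u \<le> v" "a \<le> u" "v \<le> b" by auto
      have gi: "g integrable_on {a..b}" using g by (rule set_lebesgue_integral_eq_integral)
      have "integral {a..u} g + integral {u..v} g = integral {a..v} g"
        by (rule Henstock_Kurzweil_Integration.integral_combine) (use uv in \<open>auto intro: integrable_subinterval_real[OF gi]\<close>)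
      then have "\<bar>integral {a..Sup k} g - integral {a..Inf k} g\<bar> = \<bar>integral {u..v} g\<bar>"
        using uv by simp
      also have "\<dots> \<le> integral {u..v} (\<lambda>x. \<bar>g x\<bar>)"
        using integral_norm_bound_integral[OF integrable_subinterval_real[OF gi s]
            integrable_subinterval_real[OF int_abs s]] by simp
      also have "\<dots> \<le> integral {u..v} (\<lambda>x. ?r x + real n)"
        by (intro integral_le integrable_add integrable_subinterval_real[OF int_abs s]
            integrable_subinterval_real[OF int_r s]) auto
      also have "\<dots> = integral {u..v} ?r + real n * (v - u)"
        using uv by (subst integral_add[OF integrable_subinterval_real[OF int_r s]]) auto
      finally show ?thesis using uv by simp
    qed
    have rd: "?r integrable_on k" if "k \<in> d" for k
    proof -
      obtain u v where "k = cbox u v" "k \<subseteq> \<Union>d"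
        using division_ofD(2,4)[OF d \<open>k \<in> d\<close>] by blast
      then show ?thesis using subset_trans[OF _ sub, of k] integrable_subinterval_real[OF int_r, of u v] by auto
    qed
    have "(\<Sum>k\<in>d. \<bar>integral {a..Sup k} g - integral {a..Inf k} g\<bar>)
        \<le> (\<Sum>k\<in>d. integral k ?r + real n * (Sup k - Inf k))"
      by (rule sum_mono[OF bound])
    also have "\<dots> = integral (\<Union>d) ?r + real n * (\<Sum>k\<in>d. Sup k - Inf k)"
      using integral_combine_division_bottomup[OF d rd] by (simp add: sum.distrib sum_distrib_left)
    also have "integral (\<Union>d) ?r \<le> integral {a..b} ?r"
      using sub int_r has_integral_combine_division[OF d integrable_integral[OF rd]]
      by (intro integral_subset_le) auto
    also have "real n * (\<Sum>k\<in>d. Sup k - Inf k) \<le> \<epsilon> / 2"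
      using n\<delta> len mult_left_mono[of _ \<delta> "real n"] by (meson less_imp_le of_nat_0_le_iff order_trans)
    also have "integral {a..b} ?r + \<epsilon> / 2 < \<epsilon>" using small by simp
    finally show "(\<Sum>k\<in>d. \<bar>integral {a..Sup k} g - integral {a..Inf k} g\<bar>) < \<epsilon>" by simp
  qed
qed


section \<open>Decreasing rearrangements\<close>

lemma prob_space_lebesgue_on_unit_interval: "prob_space (lebesgue_on {0..1::real})"
  by (rule prob_spaceI) (simp add: emeasure_restrict_space)

lemma measure_lebesgue_on_unit_interval:
  "measure (lebesgue_on {0..1::real}) A = measure lebesgue A" if "A \<subseteq> {0..1}"
  using that by (simp add: measure_restrict_space)

lemma cdf_distr_unit_interval:
  assumes h: "h \<in> borel_measurable (lebesgue_on {0..1})"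
  shows "cdf (distr (lebesgue_on {0..1}) borel h) \<alpha> = 1 - superlevel_measure h \<alpha>"
proof -
  interpret L: prob_space "lebesgue_on {0..1::real}" by (rule prob_space_lebesgue_on_unit_interval)
  let ?A = "{t \<in> {0..1}. h t > \<alpha>}"
  have A: "?A \<in> sets (lebesgue_on {0..1})"
    using borel_measurable_iff_greater[of h "lebesgue_on {0..1}"] h by simp
  have "cdf (distr (lebesgue_on {0..1}) borel h) \<alpha> = measure (lebesgue_on {0..1}) (h -` {..\<alpha>} \<inter> {0..1})"
    using h by (simp add: cdf_def measure_distr)
  also have "h -` {..\<alpha>} \<inter> {0..1} = space (lebesgue_on {0..1}) - ?A" by auto
  also have "measure (lebesgue_on {0..1}) \<dots> = 1 - measure (lebesgue_on {0..1}) ?A"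
    using L.prob_compl[OF A] by simp
  also have "measure (lebesgue_on {0..1}) ?A = superlevel_measure h \<alpha>"
    unfolding superlevel_measure_def by (rule measure_lebesgue_on_unit_interval) auto
  finally show ?thesis .
qed

lemma superlevel_measure_bounds:
  assumes h: "h \<in> borel_measurable (lebesgue_on {0..1})"
  shows "0 \<le> superlevel_measure h \<alpha>" "superlevel_measure h \<alpha> \<le> 1"
proof -
  interpret L: prob_space "lebesgue_on {0..1::real}" by (rule prob_space_lebesgue_on_unit_interval)
  interpret D: real_distribution "distr (lebesgue_on {0..1}) borel h"
    using h by (rule L.real_distribution_distr)
  show "0 \<le> superlevel_measure h \<alpha>" "superlevel_measure h \<alpha> \<le> 1"
    using D.cdf_bounded_prob[of \<alpha>] D.cdf_nonneg[of \<alpha>] by (auto simp: cdf_distr_unit_interval[OF h])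
qed

text \<open>
  The decreasing rearrangement at \<open>u\<close> is the quantile at \<open>1 - u\<close> of the distribution of \<open>h\<close> under
  Lebesgue measure on the unit interval, that is, a pseudoinverse of the distribution function.
  This Galois connection carries all that follows about the rearrangement.
\<close>

lemma decreasing_rearrangement_le_iff:
  assumes h: "h \<in> borel_measurable (lebesgue_on {0..1})" and u: "0 < u" "u < 1"
  shows "decreasing_rearrangement h u \<le> \<alpha> \<longleftrightarrow> superlevel_measure h \<alpha> \<le> u"
proof -
  interpret L: prob_space "lebesgue_on {0..1::real}" by (rule prob_space_lebesgue_on_unit_interval)
  interpret D: cdf_distribution "distr (lebesgue_on {0..1}) borel h"
    unfolding cdf_distribution_def using h by (rule L.real_distribution_distr)
  have iff: "1 - u \<le> D.C \<beta> \<longleftrightarrow> superlevel_measure h \<beta> \<le> u" for \<beta>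
    by (auto simp: cdf_distr_unit_interval[OF h])
  show ?thesis
    using D.pseudoinverse[of "1 - u" \<alpha>] u by (simp add: iff decreasing_rearrangement_def)
qed

lemma decreasing_rearrangement_antimono:
  assumes h: "h \<in> borel_measurable (lebesgue_on {0..1})" and "0 < u" "u \<le> v" "v < 1"
  shows "decreasing_rearrangement h v \<le> decreasing_rearrangement h u"
  using assms decreasing_rearrangement_le_iff[OF h, of u] decreasing_rearrangement_le_iff[OF h, of v]
  by (meson le_less_trans less_le_trans order.refl order_trans)

text \<open>
  The sublevel sets are intervals inside \<open>{0<..<1}\<close>. At \<open>0\<close> and \<open>1\<close> the value is unspecified, which
  changes a sublevel set by at most two points.
\<close>

lemma decreasing_rearrangement_measurable:
  assumes h: "h \<in> borel_measurable (lebesgue_on {0..1})"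
  shows "decreasing_rearrangement h \<in> borel_measurable (lebesgue_on {0..1})"
  unfolding borel_measurable_iff_le
proof
  fix \<alpha>
  let ?G = "superlevel_measure h \<alpha>"
  let ?E = "{u \<in> {0, 1}. decreasing_rearrangement h u \<le> \<alpha>}"
  have "u \<in> {0..1} \<and> decreasing_rearrangement h u \<le> \<alpha> \<longleftrightarrow> u \<in> ({?G..1} \<inter> {0<..<1}) \<union> ?E" for u
  proof (cases "0 < u \<and> u < 1")
    case True
    then show ?thesis using decreasing_rearrangement_le_iff[OF h, of u \<alpha>] by auto
  next
    case False
    then have "u \<in> {0..1} \<longleftrightarrow> u = 0 \<or> u = 1" by auto
    with False show ?thesis by auto
  qed
  then have "{u \<in> {0..1}. decreasing_rearrangement h u \<le> \<alpha>} = ({?G..1} \<inter> {0<..<1}) \<union> ?E"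
    by blast
  moreover have "({?G..1} \<inter> {0<..<1}) \<union> ?E \<in> sets lebesgue"
  proof -
    have "finite ?E" by (rule finite_subset[of _ "{0, 1}"]) auto
    then have "?E \<in> sets lborel"
      using borel_closed[OF finite_imp_closed] by (simp only: sets_lborel)
    moreover have "{?G..1} \<inter> {0<..<1} \<in> sets lborel" by simp
    ultimately show ?thesis by (intro sets_completionI_sets sets.Un)
  qed
  ultimately have "{u \<in> {0..1}. decreasing_rearrangement h u \<le> \<alpha>} \<in> sets lebesgue"
    by (simp only:)
  moreover have "{u \<in> {0..1}. decreasing_rearrangement h u \<le> \<alpha>} \<subseteq> {0..1}" by blast
  ultimately show "{u \<in> space (lebesgue_on {0..1}). decreasing_rearrangement h u \<le> \<alpha>} \<in> sets (lebesgue_on {0..1})"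
    by (subst sets_restrict_space_iff) simp_all
qed

text \<open>
  Equimeasurability: by the Galois property, the rearrangement is at most \<open>\<alpha>\<close> exactly on
  \<open>{G..1}\<close>, up to endpoints, where \<open>G\<close> is the measure of the superlevel set of \<open>h\<close>.
\<close>

lemma distr_decreasing_rearrangement:
  assumes h: "h \<in> borel_measurable (lebesgue_on {0..1})"
  shows "distr (lebesgue_on {0..1}) borel (decreasing_rearrangement h) = distr (lebesgue_on {0..1}) borel h"
    (is "distr ?L borel ?h = _")
proof (rule cdf_unique)
  interpret L: prob_space ?L by (rule prob_space_lebesgue_on_unit_interval)
  note h' = decreasing_rearrangement_measurable[OF h]
  show "real_distribution (distr ?L borel ?h)" "real_distribution (distr ?L borel h)"
    using h h' by (auto intro: L.real_distribution_distr)
  show "cdf (distr ?L borel ?h) = cdf (distr ?L borel h)"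
  proof
    fix \<alpha>
    let ?G = "superlevel_measure h \<alpha>"
    have "cdf (distr ?L borel ?h) \<alpha> = measure ?L (?h -` {..\<alpha>} \<inter> {0..1})"
      using h' by (simp add: cdf_def measure_distr)
    also have "\<dots> = measure ?L {?G..1}"
    proof (rule measure_eq_AE)
      have "{0, 1} \<in> null_sets ?L"
        by (simp add: null_sets_restrict_space)
      then show "AE u in ?L. u \<in> ?h -` {..\<alpha>} \<inter> {0..1} \<longleftrightarrow> u \<in> {?G..1}"
        by (rule AE_I') (use decreasing_rearrangement_le_iff[OF h, of _ \<alpha>] in \<open>auto simp: less_le\<close>)
      show "?h -` {..\<alpha>} \<inter> {0..1} \<in> sets ?L"
        using measurable_sets[OF h', of "{..\<alpha>}"] by simp
      show "{?G..1} \<in> sets ?L"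
        using superlevel_measure_bounds[OF h, of \<alpha>] by (simp add: sets_restrict_space_iff)
    qed
    also have "\<dots> = measure lebesgue {?G..1}"
      using superlevel_measure_bounds[OF h, of \<alpha>] by (intro measure_lebesgue_on_unit_interval) auto
    also have "\<dots> = 1 - ?G"
      using superlevel_measure_bounds[OF h, of \<alpha>] by simp
    also have "\<dots> = cdf (distr ?L borel h) \<alpha>"
      by (rule cdf_distr_unit_interval[OF h, symmetric])
    finally show "cdf (distr ?L borel ?h) \<alpha> = cdf (distr ?L borel h) \<alpha>" .
  qed
qed

lemma nn_integral_decreasing_rearrangement:
  assumes h: "h \<in> borel_measurable (lebesgue_on {0..1})" and f: "f \<in> borel_measurable borel"
  shows "(\<integral>\<^sup>+t. f (decreasing_rearrangement h t) \<partial>lebesgue_on {0..1}) = (\<integral>\<^sup>+t. f (h t) \<partial>lebesgue_on {0..1})"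
  using nn_integral_distr[OF h, of f] nn_integral_distr[OF decreasing_rearrangement_measurable[OF h], of f] f
  by (simp add: distr_decreasing_rearrangement[OF h])

lemma absolutely_integrable_on_unit_iff:
  fixes f :: "real \<Rightarrow> real"
  shows "f absolutely_integrable_on {0..1} \<longleftrightarrow> integrable (lebesgue_on {0..1}) f"
  by (simp add: set_integrable_def integrable_restrict_space)

lemma decreasing_rearrangement_absolutely_integrable:
  fixes f :: "real \<Rightarrow> real"
  assumes h: "h \<in> borel_measurable (lebesgue_on {0..1})" and f: "f \<in> borel_measurable borel"
    and fh: "(\<lambda>t. f (h t)) absolutely_integrable_on {0..1}"
  shows "(\<lambda>t. f (decreasing_rearrangement h t)) absolutely_integrable_on {0..1}"
    and "integral {0..1} (\<lambda>t. f (decreasing_rearrangement h t)) = integral {0..1} (\<lambda>t. f (h t))"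
proof -
  note h' = decreasing_rearrangement_measurable[OF h]
  have *: "integrable (lebesgue_on {0..1}) (\<lambda>t. f (h t))"
    using fh by (simp add: absolutely_integrable_on_unit_iff)
  then have **: "integrable (lebesgue_on {0..1}) (\<lambda>t. f (decreasing_rearrangement h t))"
    using f by (simp add: integrable_distr_eq[OF h, symmetric] integrable_distr_eq[OF h', symmetric]
        distr_decreasing_rearrangement[OF h])
  then show "(\<lambda>t. f (decreasing_rearrangement h t)) absolutely_integrable_on {0..1}"
    by (simp add: absolutely_integrable_on_unit_iff)
  have "integral\<^sup>L (lebesgue_on {0..1}) (\<lambda>t. f (decreasing_rearrangement h t))
      = integral\<^sup>L (lebesgue_on {0..1}) (\<lambda>t. f (h t))"
    using f by (simp add: integral_distr[OF h, symmetric] integral_distr[OF h', symmetric]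
        distr_decreasing_rearrangement[OF h])
  then show "integral {0..1} (\<lambda>t. f (decreasing_rearrangement h t)) = integral {0..1} (\<lambda>t. f (h t))"
    using * ** by (simp add: lebesgue_integral_eq_integral)
qed

text \<open>
  Let \<open>h*\<close> be the rearrangement and \<open>\<alpha> = h* t\<close>. Then
  \<open>\<integral>\<^sub>0\<^sup>t (h - \<alpha>) \<le> \<integral>\<^sub>0\<^sup>1 max 0 (h - \<alpha>) = \<integral>\<^sub>0\<^sup>1 max 0 (h* - \<alpha>) = \<integral>\<^sub>0\<^sup>t (h* - \<alpha>)\<close>:
  the middle step is equimeasurability, the last holds because \<open>h* \<ge> \<alpha>\<close> before \<open>t\<close> and
  \<open>h* \<le> \<alpha>\<close> after \<open>t\<close>.
\<close>

lemma integral_le_integral_decreasing_rearrangement: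
  fixes h :: "real \<Rightarrow> real"
  assumes h: "h absolutely_integrable_on {0..1}" and t: "t \<in> {0..1}"
  shows "integral {0..t} h \<le> integral {0..t} (decreasing_rearrangement h)" (is "_ \<le> integral _ ?h")
proof -
  have hm: "h \<in> borel_measurable (lebesgue_on {0..1})"
    using h by (simp add: absolutely_integrable_on_unit_iff)
  note tr = decreasing_rearrangement_absolutely_integrable[OF hm]
  consider "t = 0" | "t = 1" | "0 < t" "t < 1" using t by force
  then show ?thesis
  proof cases
    case 2
    then show ?thesis using tr(2)[of "\<lambda>x. x"] h by simp
  next
    case 3
    define \<alpha> where "\<alpha> = ?h t"
    have h': "?h absolutely_integrable_on {0..1}" using tr(1)[of "\<lambda>x. x"] h by simp
    have const: "(\<lambda>x::real. c) absolutely_integrable_on {0..1}" for c :: real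
      by (intro absolutely_integrable_continuous_real continuous_intros)
    have pos: "(\<lambda>x. max 0 (g x - \<alpha>)) absolutely_integrable_on {0..1}"
      if "g absolutely_integrable_on {0..1}" for g :: "real \<Rightarrow> real"
      by (intro absolutely_integrable_max_1 set_integral_diff(1) const that)
    have on: "g integrable_on {u..v}" if "g absolutely_integrable_on {0..1}" "0 \<le> u" "v \<le> 1"
      for g :: "real \<Rightarrow> real" and u v
      by (rule integrable_subinterval_real[OF set_lebesgue_integral_eq_integral(1)[OF that(1)]])
         (use that in auto)
    have shift: "integral {0..t} (\<lambda>x. g x - \<alpha>) = integral {0..t} g - \<alpha> * t"
      if "g absolutely_integrable_on {0..1}" for g :: "real \<Rightarrow> real"
      using 3 on[OF that, of 0 t] by (subst integral_diff) auto
    have "integral {0..t} h - \<alpha> * t \<le> integral {0..t} (\<lambda>x. max 0 (h x - \<alpha>))"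
      unfolding shift[OF h, symmetric]
      using 3 by (intro integral_le integrable_diff on h pos) auto
    also have "\<dots> \<le> integral {0..1} (\<lambda>x. max 0 (h x - \<alpha>))"
      using 3 by (intro integral_subset_le on pos h) auto
    also have "\<dots> = integral {0..1} (\<lambda>x. max 0 (?h x - \<alpha>))"
      by (rule tr(2)[symmetric, of "\<lambda>x. max 0 (x - \<alpha>)"]) (use pos[OF h] in auto)
    also have "\<dots> = integral {0..t} (\<lambda>x. max 0 (?h x - \<alpha>)) + integral {t..1} (\<lambda>x. max 0 (?h x - \<alpha>))"
      using 3 Henstock_Kurzweil_Integration.integral_combine[of 0 t 1 "\<lambda>x. max 0 (?h x - \<alpha>)"] on[OF pos[OF h'], of 0 1] by simp
    also have "integral {0..t} (\<lambda>x. max 0 (?h x - \<alpha>)) = integral {0..t} (\<lambda>x. ?h x - \<alpha>)"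
      by (rule integral_spike[of "{0}"])
         (use 3 decreasing_rearrangement_antimono[OF hm, of _ t] in \<open>auto simp: \<alpha>_def\<close>)
    also have "integral {t..1} (\<lambda>x. max 0 (?h x - \<alpha>)) = integral {t..1} (\<lambda>x. 0)"
      by (rule integral_spike[of "{1}"])
         (use 3 decreasing_rearrangement_antimono[OF hm, of t] in \<open>auto simp: \<alpha>_def\<close>)
    finally show ?thesis by (simp add: shift[OF h'])
  qed auto
qed

text \<open>
  A monotone function has only countably many discontinuities, so the elementary fundamental
  theorem of calculus replaces the Lebesgue differentiation theorem.
\<close>

lemma decreasing_rearrangement_primitive_has_derivative:
  fixes h :: "real \<Rightarrow> real"
  assumes h: "h absolutely_integrable_on {0..1}"
  obtains N where "negligible N" "\<And>t. t \<in> {0..1} - N \<Longrightarrow>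
    ((\<lambda>s. integral {0..s} (decreasing_rearrangement h)) has_real_derivative decreasing_rearrangement h t)
      (at t within {0..1})"
proof
  let ?h = "decreasing_rearrangement h"
  let ?N = "{t \<in> {0<..<1}. \<not> isCont (\<lambda>t. - ?h t) t} \<union> {0, 1}"
  have hm: "h \<in> borel_measurable (lebesgue_on {0..1})"
    using h by (simp add: absolutely_integrable_on_unit_iff)
  have count: "countable {t \<in> {0<..<1}. \<not> isCont (\<lambda>t. - ?h t) t}"
    by (rule mono_on_ctble_discont_open)
       (auto intro!: mono_onI decreasing_rearrangement_antimono[OF hm])
  have "countable ?N" by (intro countable_Un count) simp
  then have "?N \<in> null_sets lborel" by (rule countable_imp_null_set_lborel)
  then show "negligible ?N"
    unfolding negligible_iff_null_sets by (rule null_sets_completionI)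
  have int: "?h integrable_on {0..1}"
    using decreasing_rearrangement_absolutely_integrable(1)[OF hm, of "\<lambda>x. x"] h
    by (intro set_lebesgue_integral_eq_integral) auto
  fix t :: real assume t: "t \<in> {0..1} - ?N"
  then have "isCont (\<lambda>t. - ?h t) t" by (auto simp: less_le)
  then have "isCont ?h t" using isCont_minus by fastforce
  then show "((\<lambda>s. integral {0..s} ?h) has_real_derivative ?h t) (at t within {0..1})"
    using integral_has_vector_derivative_continuous_at[OF int, of t "{}"] t
    by (auto simp: has_real_derivative_iff_has_vector_derivative continuous_at_imp_continuous_at_within)
qed


section \<open>Monotonicity of the action\<close>

lemma log_mean_integrable:
  fixes u v :: real
  assumes "0 \<le> u" "0 \<le> v"
  shows "(\<lambda>\<xi>. u powr \<xi> * v powr (1 - \<xi>)) integrable_on {0..1}"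
proof (cases "u = 0 \<or> v = 0")
  case False
  with assms have "continuous_on {0..1} (\<lambda>\<xi>. u powr \<xi> * v powr (1 - \<xi>))"
    by (intro continuous_intros) auto
  then show ?thesis by (rule integrable_continuous_real)
qed auto

lemma log_mean_nonneg: "0 \<le> log_mean u v"
proof (cases "(\<lambda>\<xi>. u powr \<xi> * v powr (1 - \<xi>)) integrable_on {0..1}")
  case True
  then show ?thesis
    unfolding log_mean_def by (rule Henstock_Kurzweil_Integration.integral_nonneg) auto
qed (simp add: log_mean_def not_integrable_integral)

lemma log_mean_mono:
  assumes "0 \<le> u" "u \<le> u'" "0 \<le> v" "v \<le> v'"
  shows "log_mean u v \<le> log_mean u' v'"
  unfolding log_mean_def
  using assms by (intro integral_le log_mean_integrable mult_mono powr_mono2) auto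

text \<open>
  If \<open>log_mean s t = 0\<close>, then the right-hand side is infinite unless \<open>v = 0\<close>, and in that case both
  sides vanish.
\<close>

lemma action_density_antimono:
  assumes "0 \<le> s" "s \<le> s'" "0 \<le> t" "t \<le> t'"
  shows "action_density v s' t' \<le> action_density v s t"
proof (cases "log_mean s t = 0")
  case True
  then show ?thesis by (simp add: action_density_def)
next
  case False
  then have "0 < log_mean s t" using log_mean_nonneg[of s t] by simp
  moreover have "log_mean s t \<le> log_mean s' t'" using assms by (rule log_mean_mono)
  ultimately show ?thesis
    by (auto simp: action_density_def intro!: ennreal_leI divide_left_mono)
qed

lemma action_antimono:
  assumes "\<And>x. 0 \<le> \<mu> x" "\<And>x. \<mu> x \<le> \<nu> x"
  shows "action K \<pi> \<nu> V \<le> action K \<pi> \<mu> V"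
  unfolding action_def
  by (intro mult_left_mono sum_mono mult_right_mono action_density_antimono assms) auto


section \<open>The continuity equation under rearrangement of the source\<close>

text \<open>
  Discrete divergence theorem: reversibility makes the weights \<open>K x y * \<pi> x\<close> symmetric, so the
  antisymmetric flux cancels in pairs.
\<close>

lemma kernel_div_mass_zero:
  assumes "reversible_kernel K \<pi>"
  shows "(\<Sum>x\<in>UNIV. kernel_div K \<Psi> x * \<pi> x) = 0"
proof -
  let ?a = "\<lambda>x y. \<Psi> x y * (K x y * \<pi> x)"
  have rev: "?a y x = \<Psi> y x * (K x y * \<pi> x)" for x y
    using assms by (simp add: reversible_kernel_def)
  have "kernel_div K \<Psi> x * \<pi> x = 1/2 * (\<Sum>y\<in>UNIV. ?a x y - ?a y x)" for x
    unfolding kernel_div_def rev[of _ x] by (simp add: sum_distrib_left algebra_simps)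
  then have "(\<Sum>x\<in>UNIV. kernel_div K \<Psi> x * \<pi> x)
      = 1/2 * ((\<Sum>x\<in>UNIV. \<Sum>y\<in>UNIV. ?a x y) - (\<Sum>x\<in>UNIV. \<Sum>y\<in>UNIV. ?a y x))"
    by (simp add: sum_subtractf sum_distrib_left right_diff_distrib)
  also have "(\<Sum>x\<in>UNIV. \<Sum>y\<in>UNIV. ?a y x) = (\<Sum>x\<in>UNIV. \<Sum>y\<in>UNIV. ?a x y)"
    by (rule sum.swap)
  finally show ?thesis by simp
qed

lemma AE_lebesgue_on_iff_negligible:
  assumes S: "S \<in> sets lebesgue"
  shows "(AE t in lebesgue_on S. P t) \<longleftrightarrow> (\<exists>N. negligible N \<and> (\<forall>t\<in>S - N. P t))"
proof -
  have "(AE t in lebesgue_on S. P t) \<longleftrightarrow> (AE t in lebesgue. t \<in> S \<longrightarrow> P t)"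
    using S by (simp add: AE_restrict_space_iff)
  also have "\<dots> \<longleftrightarrow> (\<exists>N\<in>null_sets lebesgue. {t. \<not> (t \<in> S \<longrightarrow> P t)} \<subseteq> N)"
    by (simp add: eventually_ae_filter)
  also have "\<dots> \<longleftrightarrow> (\<exists>N. negligible N \<and> (\<forall>t\<in>S - N. P t))"
    unfolding negligible_iff_null_sets by blast
  finally show ?thesis .
qed

lemma continuity_equation_iff_negligible:
  "continuity_equation K p \<mu> V h \<longleftrightarrow> (\<exists>N. negligible N \<and> (\<forall>t\<in>{0..1} - N. \<forall>x.
     ((\<lambda>s. \<mu> s x) has_real_derivative h t * p x - kernel_div K (V t) x) (at t within {0..1})))"
proof -
  have "(\<exists>D. ((\<lambda>s. \<mu> s x) has_real_derivative D) (at t within {0..1}) \<and> D + kernel_div K (V t) x = h t * p x)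
      \<longleftrightarrow> ((\<lambda>s. \<mu> s x) has_real_derivative h t * p x - kernel_div K (V t) x) (at t within {0..1})" for t x
    by (metis add_diff_cancel diff_add_cancel)
  then show ?thesis
    unfolding continuity_equation_def by (simp add: AE_lebesgue_on_iff_negligible)
qed

text \<open>
  The difference of two solutions is absolutely continuous with derivative zero almost everywhere,
  hence constant.
\<close>

lemma solves_continuity_ivp_unique:
  assumes "solves_continuity_ivp K p \<mu>\<^sub>0 V h \<nu>" "solves_continuity_ivp K p \<mu>\<^sub>0 V h \<nu>'" and t: "t \<in> {0..1}"
  shows "\<nu> t = \<nu>' t"
proof
  fix x
  obtain N N' where N: "negligible N" "negligible N'" and
    der: "\<And>t x. t \<in> {0..1} - N \<Longrightarrow> ((\<lambda>s. \<nu> s x) has_real_derivative h t * p x - kernel_div K (V t) x) (at t within {0..1})"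
    and der': "\<And>t x. t \<in> {0..1} - N' \<Longrightarrow> ((\<lambda>s. \<nu>' s x) has_real_derivative h t * p x - kernel_div K (V t) x) (at t within {0..1})"
    using assms(1,2) unfolding solves_continuity_ivp_def continuity_equation_iff_negligible by blast
  let ?f = "\<lambda>s. \<nu> s x + (- 1) * \<nu>' s x"
  have "abs_continuous_on {0..1} ?f"
    using assms(1,2) unfolding solves_continuity_ivp_def abs_continuous_curve_def
    by (intro abs_continuous_on_add abs_continuous_on_cmult) auto
  then have ac: "abs_continuous_on {0..t} ?f"
    by (rule abs_continuous_on_subset) (use t in auto)
  have "((\<lambda>s. 0) has_integral ?f t - ?f 0) {0..t}"
  proof (rule abs_continuous_has_integral[OF _ ac])
    show "negligible (N \<union> N')" using N by simp
    fix s assume s: "s \<in> {0..t} - (N \<union> N')"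
    with t have "(?f has_real_derivative 0) (at s within {0..1})"
      by (auto intro!: derivative_eq_intros der der')
    then show "(?f has_real_derivative 0) (at s within {0..t})"
      by (rule has_field_derivative_subset) (use t in auto)
  qed (use t in auto)
  then have "?f t - ?f 0 = 0"
    by (rule has_integral_unique) (rule has_integral_0)
  moreover have "\<nu> 0 = \<nu>' 0" using assms(1,2) by (simp add: solves_continuity_ivp_def)
  ultimately show "\<nu> t x = \<nu>' t x" by simp
qed

lemma continuity_equation_mass_derivative:
  assumes "reversible_kernel K \<pi>" and mass: "(\<Sum>x\<in>UNIV. p x * \<pi> x) = 1"
    and der: "\<And>x. ((\<lambda>s. \<mu> s x) has_real_derivative c * p x - kernel_div K \<Psi> x) (at t within S)"
  shows "((\<lambda>s. \<Sum>x\<in>UNIV. \<pi> x * \<mu> s x) has_real_derivative c) (at t within S)"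
proof -
  have "((\<lambda>s. \<Sum>x\<in>UNIV. \<pi> x * \<mu> s x) has_real_derivative
      (\<Sum>x\<in>UNIV. \<pi> x * (c * p x - kernel_div K \<Psi> x))) (at t within S)"
    by (intro DERIV_sum DERIV_cmult der)
  also have "(\<Sum>x\<in>UNIV. \<pi> x * (c * p x - kernel_div K \<Psi> x))
      = c * (\<Sum>x\<in>UNIV. p x * \<pi> x) - (\<Sum>x\<in>UNIV. kernel_div K \<Psi> x * \<pi> x)"
    by (simp add: sum_distrib_left sum_subtractf algebra_simps)
  also have "\<dots> = c" using mass kernel_div_mass_zero[OF assms(1)] by simp
  finally show ?thesis .
qed

theorem lemma3p6:
  fixes K :: "'x::finite \<Rightarrow> 'x \<Rightarrow> real"
    and \<pi> p \<mu>\<^sub>0 \<mu>\<^sub>1 :: "'x \<Rightarrow> real"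
    and a b :: real
    and \<mu> :: "real \<Rightarrow> 'x \<Rightarrow> real"
    and V :: "real \<Rightarrow> 'x \<Rightarrow> 'x \<Rightarrow> real"
    and h :: "real \<Rightarrow> real"
  assumes "markov_kernel K" and "irreducible_kernel K"
    and "invariant_probability K \<pi>" and "reversible_kernel K \<pi>"
    and "a > 0" and "b > 0"
    and "p \<in> pos_densities" and "(\<Sum>x\<in>UNIV. p x * \<pi> x) = 1"
    and "\<mu>\<^sub>0 \<in> nonneg_densities" and "\<mu>\<^sub>1 \<in> nonneg_densities"
    and "(\<mu>, V, h) \<in> CE K p \<mu>\<^sub>0 \<mu>\<^sub>1"
  shows "\<exists>\<nu>. solves_continuity_ivp K p \<mu>\<^sub>0 V (decreasing_rearrangement h) \<nu> \<and>
           (\<forall>\<nu>'. solves_continuity_ivp K p \<mu>\<^sub>0 V (decreasing_rearrangement h) \<nu>'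
                 \<longrightarrow> (\<forall>t\<in>{0..1}. \<nu>' t = \<nu> t)) \<and>
           (\<nu>, V, decreasing_rearrangement h) \<in> CE K p \<mu>\<^sub>0 \<mu>\<^sub>1 \<and>
           energy_quad K \<pi> a b (\<mu>, V, h) \<ge> energy_quad K \<pi> a b (\<nu>, V, decreasing_rearrangement h)"
proof -
  let ?h = "decreasing_rearrangement h"
  from assms(11) have \<mu>_nonneg: "\<And>t x. t \<in> {0..1} \<Longrightarrow> 0 \<le> \<mu> t x"
    and ac: "\<And>x. abs_continuous_on {0..1} (\<lambda>t. \<mu> t x)"
    and ends: "\<mu> 0 = \<mu>\<^sub>0" "\<mu> 1 = \<mu>\<^sub>1"
    and V: "\<And>x y. (\<lambda>t. V t x y) \<in> borel_measurable (lebesgue_on {0..1})"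
    and hm: "h \<in> borel_measurable (lebesgue_on {0..1})"
    and ce: "continuity_equation K p \<mu> V h"
    by (auto simp: CE_def nonneg_densities_def abs_continuous_curve_def)
  have p: "0 \<le> p x" for x using assms(7) by (auto simp: pos_densities_def less_imp_le)
  obtain N where N: "negligible N" and der: "\<And>t x. t \<in> {0..1} - N \<Longrightarrow>
      ((\<lambda>s. \<mu> s x) has_real_derivative h t * p x - kernel_div K (V t) x) (at t within {0..1})"
    using ce unfolding continuity_equation_iff_negligible by blast

  \<comment> \<open>The total mass \<open>M\<close> is absolutely continuous with derivative \<open>h\<close> almost everywhere; this is what
      makes \<open>h\<close> integrable and identifies its primitive.\<close>
  define M where "M t = (\<Sum>x\<in>UNIV. \<pi> x * \<mu> t x)" for t
  have M_ac: "abs_continuous_on {0..1} M"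
    unfolding M_def by (intro abs_continuous_on_sum abs_continuous_on_cmult ac)
  have M_der: "(M has_real_derivative h t) (at t within {0..1})" if "t \<in> {0..1} - N" for t
    unfolding M_def
    by (rule continuity_equation_mass_derivative[where \<Psi> = "V t", OF assms(4,8)]) (rule der[OF that])
  have h: "h absolutely_integrable_on {0..1}"
    by (rule abs_continuous_absolutely_integrable[OF _ M_ac N M_der]) auto
  have h_int: "integral {0..t} h = M t - M 0" if t: "t \<in> {0..1}" for t
  proof (intro integral_unique abs_continuous_has_integral[OF _ _ N])
    show "abs_continuous_on {0..t} M"
      by (rule abs_continuous_on_subset[OF M_ac]) (use t in auto)
    show "(M has_real_derivative h s) (at s within {0..t})" if "s \<in> {0..t} - N" for s
      by (rule has_field_derivative_subset[OF M_der]) (use t that in auto)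
  qed (use t in auto)

  have h': "?h absolutely_integrable_on {0..1}" and h'_total: "integral {0..1} ?h = integral {0..1} h"
    using decreasing_rearrangement_absolutely_integrable[OF hm, of "\<lambda>x. x"] h by auto
  obtain N' where N': "negligible N'" and der': "\<And>t. t \<in> {0..1} - N' \<Longrightarrow>
      ((\<lambda>s. integral {0..s} ?h) has_real_derivative ?h t) (at t within {0..1})"
    using decreasing_rearrangement_primitive_has_derivative[OF h] by blast

  \<comment> \<open>\<open>W\<close> is the primitive of \<open>h* - h\<close>, written with \<open>M\<close> so that its derivative is known almost
      everywhere.\<close>
  define W where "W t = integral {0..t} ?h - (M t - M 0)" for t
  have W0: "W 0 = 0" and W1: "W 1 = 0"
    using h'_total h_int[of 1] by (simp_all add: W_def)
  have W_nonneg: "0 \<le> W t" if "t \<in> {0..1}" for t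
    using integral_le_integral_decreasing_rearrangement[OF h that] h_int[OF that] by (simp add: W_def)
  have "abs_continuous_on {0..1} (\<lambda>t. integral {0..t} ?h + ((- 1) * M t + M 0))"
    by (intro abs_continuous_on_add abs_continuous_on_cmult abs_continuous_on_const M_ac
        abs_continuous_on_indefinite_integral h')
  then have W_ac: "abs_continuous_on {0..1} W" by (simp add: W_def[abs_def] algebra_simps)
  have W_der: "(W has_real_derivative ?h t - h t) (at t within {0..1})" if "t \<in> {0..1} - (N \<union> N')" for t
    unfolding W_def[abs_def] using that by (auto intro!: derivative_eq_intros M_der der')

  define \<nu> where "\<nu> t x = \<mu> t x + p x * W t" for t x
  have \<nu>_ge: "\<mu> t x \<le> \<nu> t x" if "t \<in> {0..1}" for t x
    using p W_nonneg[OF that] by (simp add: \<nu>_def)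
  have \<nu>_ac: "abs_continuous_curve \<nu>"
    unfolding abs_continuous_curve_def \<nu>_def
    by (intro allI abs_continuous_on_add abs_continuous_on_cmult ac W_ac)
  have \<nu>_ends: "\<nu> 0 = \<mu>\<^sub>0" "\<nu> 1 = \<mu>\<^sub>1"
    using ends by (auto simp: \<nu>_def W0 W1)
  have \<nu>_ce: "continuity_equation K p \<nu> V ?h"
    unfolding continuity_equation_iff_negligible
  proof (intro exI[of _ "N \<union> N'"] conjI ballI allI)
    fix t x assume t: "t \<in> {0..1} - (N \<union> N')"
    then have "((\<lambda>s. \<mu> s x + p x * W s) has_real_derivative
        (h t * p x - kernel_div K (V t) x) + p x * (?h t - h t)) (at t within {0..1})"
      by (intro DERIV_add DERIV_cmult der W_der) auto
    then show "((\<lambda>s. \<nu> s x) has_real_derivative ?h t * p x - kernel_div K (V t) x) (at t within {0..1})"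
      by (simp add: \<nu>_def algebra_simps)
  qed (use N N' in auto)
  have sol: "solves_continuity_ivp K p \<mu>\<^sub>0 V ?h \<nu>"
    using \<nu>_ac \<nu>_ends \<nu>_ce by (simp add: solves_continuity_ivp_def)
  have "(\<nu>, V, ?h) \<in> CE K p \<mu>\<^sub>0 \<mu>\<^sub>1"
    using \<nu>_ac \<nu>_ends \<nu>_ce V decreasing_rearrangement_measurable[OF hm] order_trans[OF \<mu>_nonneg \<nu>_ge]
    by (auto simp: CE_def nonneg_densities_def)
  moreover have "energy_quad K \<pi> a b (\<nu>, V, ?h) \<le> energy_quad K \<pi> a b (\<mu>, V, h)"
  proof -
    have "(\<integral>\<^sup>+t. ennreal (\<bar>?h t\<bar>\<^sup>2) \<partial>lebesgue_on {0..1}) = (\<integral>\<^sup>+t. ennreal (\<bar>h t\<bar>\<^sup>2) \<partial>lebesgue_on {0..1})"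
      by (rule nn_integral_decreasing_rearrangement[OF hm, of "\<lambda>x. ennreal (\<bar>x\<bar>\<^sup>2)"]) measurable
    moreover have "(\<integral>\<^sup>+t. action K \<pi> (\<nu> t) (V t) \<partial>lebesgue_on {0..1})
        \<le> (\<integral>\<^sup>+t. action K \<pi> (\<mu> t) (V t) \<partial>lebesgue_on {0..1})"
      by (intro nn_integral_mono action_antimono) (auto intro: \<mu>_nonneg \<nu>_ge)
    ultimately show ?thesis
      by (auto simp: energy_quad_def intro!: add_left_mono mult_left_mono)
  qed
  ultimately show ?thesis
    using sol solves_continuity_ivp_unique[OF _ sol] by blast
qed

end
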